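(* For even $n\ge 6$, if $K\subset\mathbb{R}^2$ is an $o$-symmetric convex polygon of at most $n$ vertices, then $$V(K)\,V(K^* )\le n^2\sin^2\frac{\pi}{n},$$ with equality if and only if $K$ is a regular $n$-gon.
   Context: $o$ denotes the origin of $\mathbb{R}^2$; a set $K$ is $o$-symmetric if $K=-K$. $V(\cdot)$ denotes area. Convex polygons are understood to have nonempty interior. For a convex body $K$ with $o$ in its interior, $K^*=\{x\in\mathbb{R}^2:\langle x,y\rangle\le 1\text{ for all }y\in K\}$ is its polar body.
   Formalization: In the equality case "regular n-gon" is replaced by "affinely regular n-gon" (image of a regular n-gon under an invertible affine map), since the area product is invariant under linear maps and, e.g., a linearly stretched regular hexagon also attains equality for n = 6. *)

theory Defs
  imports "HOL-Analysis.Analysis"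
begin

definition o_symmetric :: "'a::real_vector set \<Rightarrow> bool" where
  "o_symmetric K \<longleftrightarrow> K = uminus ` K"

definition polar_body :: "'a::real_inner set \<Rightarrow> 'a set" where
  "polar_body K = {x. \<forall>y\<in>K. x \<bullet> y \<le> 1}"

definition convex_polygon :: "(real^2) set \<Rightarrow> bool" where
  "convex_polygon K \<longleftrightarrow> polytope K \<and> interior K \<noteq> {}"

text \<open>The set of extreme points of a polytope is finite, so the cardinality of this set is
  the number of vertices of a convex polygon.\<close>

definition vertices :: "(real^2) set \<Rightarrow> (real^2) set" where
  "vertices K = {v. v extreme_point_of K}"

definition regular_polygon :: "nat \<Rightarrow> (real^2) set \<Rightarrow> bool" where
  "regular_polygon n P \<longleftrightarrow> n \<ge> 3 \<and>
     (\<exists>c r \<theta>. r > 0 \<and>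
        P = convex hull
          ((\<lambda>k. c + r *\<^sub>R vector [cos (\<theta> + 2 * pi * real k / real n),
                               sin (\<theta> + 2 * pi * real k / real n)]) ` {..<n}))"

text \<open>The area product of a polygon and its polar is invariant under invertible linear maps,
  so its extremal polygons can be regular only up to such maps.  Hence the equality case is
  expressed by affinely regular polygons, the images of regular ones under invertible affine
  maps.  (If the image is symmetric about the origin and the number of vertices is even, then
  it is a linear image of a regular polygon centred at the origin.)\<close>

definition affinely_regular_polygon :: "nat \<Rightarrow> (real^2) set \<Rightarrow> bool" where
  "affinely_regular_polygon n K \<longleftrightarrow>
     (\<exists>P A b. regular_polygon n P \<and> linear A \<and> inj A \<and> K = (\<lambda>x. A x + b) ` P)"

end

theory Submission
  imports Defs
begin

text \<open>Let \<open>K\<close> have the vertices \<open>v i\<close> with \<open>v (i + m) = - v i\<close>, and put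
  \<open>a i = det (v i, v (i + 1))\<close>. Then \<open>V(K) = \<Sum>i<m. a i\<close> and \<open>V(K\<^sup>*) = \<Sum>i<m. 2 / a i - q i\<close>, where \<open>q\<close> is the
  potential of the discrete Hill equation satisfied by the vertices. As the vertices make only half a
  turn over one antiperiod, the quadratic form of this equation is negative semidefinite on
  antiperiodic sequences (Jacobi), with the linear functionals of the vertices as kernel. Testing it
  with the cosine and the sine of angles increasing by \<open>2 * x i\<close>, where \<open>x\<close> has sum \<open>pi / 2\<close>, gives
  \<open>V(K\<^sup>*) \<le> \<Sum>i<m. 4 * sin (x i) ^ 2 / a i\<close>. For the choice \<open>sin (x i) = l * a i\<close> this says
  \<open>V(K) * V(K\<^sup>*) \<le> 4 * (\<Sum>i<m. sin (x i)) ^ 2\<close>, and concavity of the sine finishes the proof. Equality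
  forces all \<open>x i\<close> to be equal and the cosine and sine sequences to be linear functionals of the
  vertices, i.e. \<open>K\<close> is affinely regular.\<close>

section \<open>Determinants in the plane\<close>

definition cr :: "real^2 \<Rightarrow> real^2 \<Rightarrow> real"
  where "cr u v = u$1 * v$2 - u$2 * v$1"

lemma vec2_eq_iff: "x = y \<longleftrightarrow> x$1 = y$1 \<and> x$2 = y$2" for x y :: "real^2"
  by (simp add: vec_eq_iff forall_2)

lemma inner_vec2: "x \<bullet> y = x$1 * y$1 + x$2 * y$2" for x y :: "real^2"
  by (simp add: inner_vec_def sum_2)

lemma cr_anticomm: "cr y x = - cr x y"
  by (simp add: cr_def)

lemma cr_self [simp]: "cr x x = 0"
  by (simp add: cr_def)

lemma cr_minus [simp]: "cr (- x) y = - cr x y" "cr x (- y) = - cr x y"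
  by (simp_all add: cr_def)

lemma cr_scaleR [simp]: "cr (c *\<^sub>R x) y = c * cr x y" "cr x (c *\<^sub>R y) = c * cr x y"
  by (simp_all add: cr_def algebra_simps)

lemma cr_add: "cr (x + x') y = cr x y + cr x' y" "cr x (y + y') = cr x y + cr x y'"
  by (simp_all add: cr_def algebra_simps)

lemma cramer: "cr x y *\<^sub>R z = cr z y *\<^sub>R x + cr x z *\<^sub>R y"
  by (simp add: vec2_eq_iff cr_def algebra_simps)

text \<open>Presents \<open>cr x\<close> as an inner product with a fixed vector, so that facts on
  hyperplanes and on functionals \<open>d \<bullet> v i\<close> apply to it.\<close>

lemma inner_minus_perp: "vector [- x$2, x$1] \<bullet> y = cr x y"
  by (simp add: inner_vec2 cr_def)

lemma negligible_line:
  assumes "x \<noteq> 0" shows "negligible {y. cr x y = 0}"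
proof -
  have "vector [- x$2, x$1] \<noteq> (0::real^2)"
    using assms by (auto simp: vec2_eq_iff)
  then show ?thesis
    using negligible_hyperplane[of "vector [- x$2, x$1] :: real^2" 0] by (simp add: inner_minus_perp)
qed

section \<open>Areas of symmetric fans of triangles\<close>

text \<open>The half turn \<open>v 0, \<dots>, v m = - v 0\<close> of the vertices of a symmetric \<open>2m\<close>-gon, continued
  antiperiodically to all natural numbers, so that no indices modulo \<open>2m\<close> occur.\<close>

locale symmetric_fan =
  fixes m :: nat and v :: "nat \<Rightarrow> real^2"
  assumes antiperiodic: "v (i + m) = - v i"
    and consecutive_pos: "cr (v i) (v (Suc i)) > 0"
begin

definition sector :: "nat \<Rightarrow> (real^2) set"
  where "sector i = convex hull {0, v i, v (Suc i)}"

lemma nonzero: "v i \<noteq> 0"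
  using consecutive_pos[of i] by (auto simp: cr_def)

lemma m_pos: "m > 0"
  using antiperiodic[of 0] nonzero[of 0] by (cases m) (auto simp: vec2_eq_iff)

lemma periodic: "v (i + 2 * m) = v i"
  using antiperiodic[of "i + m"] antiperiodic[of i] by (simp add: mult_2 add.assoc)

lemma sum_double:
  fixes f :: "real^2 \<Rightarrow> real^2 \<Rightarrow> real"
  assumes "\<And>x y. f (- x) (- y) = f x y"
  shows "(\<Sum>i<2*m. f (v i) (v (Suc i))) = 2 * (\<Sum>i<m. f (v i) (v (Suc i)))"
proof -
  have "(\<Sum>i<2*m. f (v i) (v (Suc i))) =
      (\<Sum>i<m. f (v i) (v (Suc i))) + (\<Sum>i=m..<2*m. f (v i) (v (Suc i)))"
    using sum.atLeastLessThan_concat[of 0 m "2*m" "\<lambda>i. f (v i) (v (Suc i))"]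
    by (simp add: lessThan_atLeast0)
  also have "(\<Sum>i=m..<2*m. f (v i) (v (Suc i))) = (\<Sum>i<m. f (v (i + m)) (v (Suc i + m)))"
    using sum.shift_bounds_nat_ivl[of "\<lambda>i. f (v i) (v (Suc i))" 0 m m]
    by (simp add: lessThan_atLeast0 mult_2)
  also have "\<dots> = (\<Sum>i<m. f (v i) (v (Suc i)))"
    by (simp only: antiperiodic assms)
  finally show ?thesis by simp
qed

lemma measure_sector: "measure lebesgue (sector i) = cr (v i) (v (Suc i)) / 2"
proof -
  have "measure lborel (sector i) = \<bar>cr (v i) (v (Suc i))\<bar> / 2"
    unfolding sector_def by (subst content_triangle) (simp add: cr_def algebra_simps abs_minus_commute)
  then show ?thesis
    using consecutive_pos[of i]
    by (simp add: sector_def measure_completion borel_closed compact_imp_closed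
        finite_imp_compact_convex_hull)
qed

lemma sector_lmeasurable: "sector i \<in> lmeasurable"
  by (simp add: sector_def lmeasurable_compact finite_imp_compact_convex_hull)

lemma sector_signs:
  assumes "x \<in> sector i" shows "cr (v i) x \<ge> 0" "cr x (v (Suc i)) \<ge> 0"
  using assms consecutive_pos[of i]
  by (auto simp: sector_def convex_hull_3 cr_add)

text \<open>The sequence \<open>cr (v i) x\<close> is antiperiodic, so within one full period it
  passes from nonnegative to nonpositive. This discrete intermediate value argument finds a cone
  containing \<open>x\<close> without any angles.\<close>

lemma ex_consecutive_signs: "\<exists>i<2*m. cr (v i) x \<ge> 0 \<and> cr x (v (Suc i)) \<ge> 0"
proof -
  have *: "\<exists>i. a \<le> i \<and> i < a + m \<and> f i \<ge> 0 \<and> f (Suc i) \<le> 0"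
    if "f a \<ge> 0" "f (a + m) \<le> 0" for a and f :: "nat \<Rightarrow> real"
  proof (rule ccontr)
    assume no: "\<not> ?thesis"
    have nonneg: "f (a + k) \<ge> 0" if "k \<le> m" for k
      using that
    proof (induction k)
      case (Suc k)
      then have "f (a + k) \<ge> 0" "a \<le> a + k" "a + k < a + m" by auto
      then have "\<not> f (Suc (a + k)) \<le> 0" using no by blast
      then show ?case by simp
    qed (use \<open>f a \<ge> 0\<close> in simp)
    obtain k where "m = Suc k" using m_pos not0_implies_Suc by blast
    then show False
      using no nonneg[of k] \<open>f (a + m) \<le> 0\<close> by (auto dest!: spec[of _ "a + k"])
  qed
  define f where "f i = cr (v i) x" for i
  have f: "f (i + m) = - f i" for i by (simp add: f_def antiperiodic)
  obtain i where "i < 2 * m" "f i \<ge> 0" "f (Suc i) \<le> 0"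
  proof (cases "f 0 \<ge> 0")
    case True
    then obtain i where "i < m" "f i \<ge> 0" "f (Suc i) \<le> 0"
      using *[of f 0] f[of 0] by auto
    then show ?thesis using that[of i] by auto
  next
    case False
    then obtain i where "i < m + m" "f i \<ge> 0" "f (Suc i) \<le> 0"
      using *[of f m] f[of 0] f[of m] by auto
    then show ?thesis using that[of i] by auto
  qed
  then show ?thesis using cr_anticomm[of x] by (auto simp: f_def)
qed

text \<open>The coordinates of \<open>x\<close> with respect to the edge of its cone are
  nonnegative, and \<open>g i\<close>, the functional equal to 1 on that edge, bounds their sum by
  1. For the polygon \<open>g\<close> will be the dual vertices, for the polar body the
  vertices.\<close>

lemma subset_sectors:
  assumes "\<And>i. g i \<bullet> v i = 1" "\<And>i. g i \<bullet> v (Suc i) = 1"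
    and "\<And>i x. x \<in> S \<Longrightarrow> g i \<bullet> x \<le> 1"
  shows "S \<subseteq> (\<Union>i<2*m. sector i)"
proof
  fix x assume "x \<in> S"
  obtain i where i: "i < 2 * m" "cr (v i) x \<ge> 0" "cr x (v (Suc i)) \<ge> 0"
    using ex_consecutive_signs by blast
  define s t where "s = cr x (v (Suc i)) / cr (v i) (v (Suc i))"
    and "t = cr (v i) x / cr (v i) (v (Suc i))"
  have st: "s \<ge> 0" "t \<ge> 0"
    using i consecutive_pos[of i] by (simp_all add: s_def t_def)
  have x: "x = s *\<^sub>R v i + t *\<^sub>R v (Suc i)"
  proof -
    have "x = (1 / cr (v i) (v (Suc i))) *\<^sub>R (cr (v i) (v (Suc i)) *\<^sub>R x)"
      using consecutive_pos[of i] by simp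
    then show ?thesis
      by (subst (asm) cramer) (simp add: s_def t_def algebra_simps)
  qed
  have "s + t \<le> 1"
    using assms(3)[OF \<open>x \<in> S\<close>, of i] unfolding x by (simp add: inner_add_right assms)
  then have "x \<in> sector i"
    unfolding sector_def convex_hull_3 using st x
    by (intro CollectI exI[of _ "1 - s - t"] exI[of _ s] exI[of _ t]) auto
  then show "x \<in> (\<Union>i<2*m. sector i)" using i by blast
qed

lemma lmeasurable:
  assumes "closed S" "\<And>i. g i \<bullet> v i = 1" "\<And>i. g i \<bullet> v (Suc i) = 1"
    and "\<And>i x. x \<in> S \<Longrightarrow> g i \<bullet> x \<le> 1"
  shows "S \<in> lmeasurable"
proof -
  have "bounded (\<Union>i<2*m. sector i)"
    by (auto simp: sector_def finite_imp_bounded_convex_hull)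
  then have "bounded S" using subset_sectors[of g S] assms bounded_subset by blast
  then show ?thesis
    using assms by (simp add: lmeasurable_compact compact_eq_bounded_closed)
qed

lemma sum_measure_sectors:
  "(\<Sum>i<2*m. measure lebesgue (sector i)) = (\<Sum>i<m. cr (v i) (v (Suc i)))"
  using sum_double[of cr] by (simp add: measure_sector flip: sum_divide_distrib)

text \<open>Covering by the triangles suffices for an upper bound on the area; overlaps only
  help.\<close>

lemma measure_le:
  assumes "closed S" "\<And>i. g i \<bullet> v i = 1" "\<And>i. g i \<bullet> v (Suc i) = 1"
    and "\<And>i x. x \<in> S \<Longrightarrow> g i \<bullet> x \<le> 1"
  shows "measure lebesgue S \<le> (\<Sum>i<m. cr (v i) (v (Suc i)))"
proof -
  have "measure lebesgue S \<le> measure lebesgue (\<Union>i<2*m. sector i)"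
    using subset_sectors[of g S] assms
    by (intro measure_mono_fmeasurable) (auto intro!: fmeasurable.finite_UN sector_lmeasurable)
  also have "\<dots> \<le> (\<Sum>i<2*m. measure lebesgue (sector i))"
    by (rule measure_UNION_le) (auto simp: sector_lmeasurable fmeasurableD)
  finally show ?thesis by (simp add: sum_measure_sectors)
qed

text \<open>Expanding \<open>x\<close> in \<open>v i\<close> and \<open>v (Suc i)\<close> shows
  \<open>cr x y > 0\<close> for every \<open>y\<close> that comes after both within half a turn. For
  \<open>j < i + m\<close> the choice \<open>y = v j\<close> contradicts
  \<open>cr (v j) x > 0\<close>. Otherwise \<open>v j = - v k\<close> with \<open>k = j - m\<close>,
  and \<open>k = i\<close> is immediate while \<open>y = v (Suc k)\<close> settles
  \<open>k > i\<close>.\<close>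

lemma sectors_disjoint:
  assumes pos: "\<And>i j. i < j \<Longrightarrow> j < i + m \<Longrightarrow> cr (v i) (v j) > 0"
    and ij: "i < j" "j < 2 * m"
    and x: "cr (v i) x > 0" "cr x (v (Suc i)) > 0" "cr (v j) x > 0" "cr x (v (Suc j)) > 0"
  shows False
proof -
  have eq: "cr (v i) (v (Suc i)) * cr x y = cr x (v (Suc i)) * cr (v i) y + cr (v i) x * cr (v (Suc i)) y" for y
    using arg_cong[OF cramer[of "v i" "v (Suc i)" x], of "\<lambda>z. cr z y"] by (simp add: cr_add)
  have key: "cr x y > 0" if "cr (v i) y > 0 \<and> cr (v (Suc i)) y \<ge> 0 \<or> cr (v i) y \<ge> 0 \<and> cr (v (Suc i)) y > 0" for y
  proof -
    have "cr (v i) (v (Suc i)) * cr x y > 0"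
      unfolding eq using that x by (auto intro: add_pos_nonneg add_nonneg_pos)
    then show ?thesis using consecutive_pos[of i] by (simp add: zero_less_mult_iff)
  qed
  show False
  proof (cases "j < i + m")
    case True
    have "cr (v (Suc i)) (v j) \<ge> 0"
      using pos[of "Suc i" j] ij True by (cases "j = Suc i") auto
    then have "cr x (v j) > 0" using pos[OF \<open>i < j\<close> True] by (intro key) auto
    then show False using x(3) cr_anticomm[of x "v j"] by simp
  next
    case False
    define k where "k = j - m"
    have k: "j = k + m" "i \<le> k" "k < i + m" using False ij by (auto simp: k_def)
    have n: "cr (v k) x < 0" "cr x (v (Suc k)) < 0"
      using x(3,4) antiperiodic[of k] antiperiodic[of "Suc k"] by (auto simp: k)
    show False
    proof (cases "k = i")
      case True
      then show False using n x by simp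
    next
      case False
      have "cr (v i) (v (Suc k)) \<ge> 0"
        using pos[of i "Suc k"] k False antiperiodic[of i] by (cases "Suc k = i + m") auto
      moreover have "cr (v (Suc i)) (v (Suc k)) > 0"
        using pos[of "Suc i" "Suc k"] k False by auto
      ultimately have "cr x (v (Suc k)) > 0" by (intro key) auto
      then show False using n by simp
    qed
  qed
qed

text \<open>The triangles fill \<open>S\<close>, and two of them can meet only on the lines through
  the origin and one of their vertices, which is a null set.\<close>

lemma measure_eq:
  assumes pos: "\<And>i j. i < j \<Longrightarrow> j < i + m \<Longrightarrow> cr (v i) (v j) > 0"
    and S: "convex S" "0 \<in> S" "\<And>i. v i \<in> S"
    and g: "\<And>i. g i \<bullet> v i = 1" "\<And>i. g i \<bullet> v (Suc i) = 1"
      "\<And>i x. x \<in> S \<Longrightarrow> g i \<bullet> x \<le> 1"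
  shows "measure lebesgue S = (\<Sum>i<m. cr (v i) (v (Suc i)))"
proof -
  have "sector i \<subseteq> S" for i
    unfolding sector_def using S by (intro hull_minimal) auto
  then have "S = (\<Union>i<2*m. sector i)"
    using subset_sectors[of g S] g by blast
  moreover have neg: "negligible (sector i \<inter> sector j)" if "i < j" "j < 2 * m" for i j
  proof (rule negligible_subset)
    let ?L = "\<lambda>i. {y. cr (v i) y = 0}"
    show "negligible (?L i \<union> ?L (Suc i) \<union> ?L j \<union> ?L (Suc j))"
      by (intro negligible_Un negligible_line nonzero)
    show "sector i \<inter> sector j \<subseteq> ?L i \<union> ?L (Suc i) \<union> ?L j \<union> ?L (Suc j)"
    proof
      fix x assume "x \<in> sector i \<inter> sector j"
      then have "cr (v i) x \<ge> 0" "cr x (v (Suc i)) \<ge> 0" "cr (v j) x \<ge> 0" "cr x (v (Suc j)) \<ge> 0"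
        using sector_signs by auto
      then show "x \<in> ?L i \<union> ?L (Suc i) \<union> ?L j \<union> ?L (Suc j)"
        using sectors_disjoint[OF pos that, of x] cr_anticomm[of x]
        by (fastforce simp: less_le)
    qed
  qed
  have "measure lebesgue (\<Union>i<2*m. sector i) = (\<Sum>i<2*m. measure lebesgue (sector i))"
  proof (rule measure_negligible_finite_Union_image)
    show "pairwise (\<lambda>i j. negligible (sector i \<inter> sector j)) {..<2*m}"
      unfolding pairwise_def
    proof (intro ballI impI)
      fix i j assume "i \<in> {..<2*m}" "j \<in> {..<2*m}" "i \<noteq> j"
      then show "negligible (sector i \<inter> sector j)"
        using neg[of i j] neg[of j i] by (cases "i < j") (auto simp: Int_commute)
    qed
  qed (auto simp: sector_lmeasurable)
  ultimately show ?thesis by (simp add: sum_measure_sectors)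
qed

end

section \<open>Tools for the sine, Jacobi's substitution and polar bodies\<close>

lemma sin_le_tangent:
  assumes "0 \<le> x" "x \<le> pi / 2" "0 \<le> c" "c \<le> pi / 2"
  shows "sin x \<le> sin c + cos c * (x - c)"
    and "x \<noteq> c \<Longrightarrow> sin x < sin c + cos c * (x - c)"
proof -
  show strict: "sin x < sin c + cos c * (x - c)" if "x \<noteq> c"
  proof (cases "x < c")
    case True
    obtain z where z: "x < z" "z < c" "sin c - sin x = (c - x) * cos z"
      using MVT2[OF True, of sin cos] by (auto intro: DERIV_sin)
    then have "cos c < cos z" using assms by (intro cos_monotone_0_pi) auto
    then have "(c - x) * cos c < (c - x) * cos z" using True by simp
    then show ?thesis using z by (simp add: algebra_simps)
  next
    case False
    then have "c < x" using that by simp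
    obtain z where z: "c < z" "z < x" "sin x - sin c = (x - c) * cos z"
      using MVT2[OF \<open>c < x\<close>, of sin cos] by (auto intro: DERIV_sin)
    then have "cos z < cos c" using assms by (intro cos_monotone_0_pi) auto
    then have "(x - c) * cos z < (x - c) * cos c" using \<open>c < x\<close> by simp
    then show ?thesis using z by (simp add: algebra_simps)
  qed
  then show "sin x \<le> sin c + cos c * (x - c)" by (cases "x = c") auto
qed

text \<open>Padding with zeros up to \<open>N\<close> terms and concavity of the sine; this also covers polygons with
  fewer than \<open>n\<close> vertices.\<close>

lemma sum_sin_le:
  fixes x :: "nat \<Rightarrow> real" and N :: nat
  assumes x: "\<And>i. i < m \<Longrightarrow> 0 \<le> x i \<and> x i \<le> pi / 2" "(\<Sum>i<m. x i) = pi / 2" and N: "m \<le> N" "N > 0"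
  shows "(\<Sum>i<m. sin (x i)) \<le> N * sin (pi / (2 * N))"
    and "(\<Sum>i<m. sin (x i)) = N * sin (pi / (2 * N)) \<Longrightarrow> m = N \<and> (\<forall>i<m. x i = pi / (2 * N))"
proof -
  define c where "c = pi / (2 * N)"
  have c: "0 < c" "c \<le> pi / 2" "N * c = pi / 2"
    using N by (auto simp: c_def field_simps)
  \<comment> \<open>The tangent at \<open>c\<close> is strictly positive at 0, so each padded zero
    loses a positive amount. Equality therefore forces \<open>m = N\<close>.\<close>
  have zero: "0 < sin c + cos c * (0 - c)"
    using sin_le_tangent(2)[of 0 c] c by simp
  have "(\<Sum>i<m. sin c + cos c * (x i - c)) + (N - m) * (sin c + cos c * (0 - c))
      = N * sin c + cos c * ((\<Sum>i<m. x i) - N * c)"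
    using N by (simp add: sum.distrib sum_subtractf of_nat_diff algebra_simps flip: sum_distrib_left)
  then have tot: "(\<Sum>i<m. sin c + cos c * (x i - c)) + (N - m) * (sin c + cos c * (0 - c)) = N * sin c"
    using x c by simp
  have le: "(\<Sum>i<m. sin (x i)) \<le> (\<Sum>i<m. sin c + cos c * (x i - c))"
    using sin_le_tangent(1) x c by (intro sum_mono) auto
  have pad: "0 \<le> real (N - m) * (sin c + cos c * (0 - c))"
    using zero by (intro mult_nonneg_nonneg) auto
  show "(\<Sum>i<m. sin (x i)) \<le> N * sin (pi / (2 * N))"
    using tot le pad by (simp add: c_def)
  assume "(\<Sum>i<m. sin (x i)) = N * sin (pi / (2 * N))"
  then have eq: "(\<Sum>i<m. sin (x i)) = N * sin c" by (simp add: c_def)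
  then have "real (N - m) * (sin c + cos c * (0 - c)) = 0"
    using tot le pad by linarith
  then have "m = N" using zero N by simp
  have "x i = c" if "i < m" for i
  proof (rule ccontr)
    assume "x i \<noteq> c"
    then have "(\<Sum>i<m. sin (x i)) < (\<Sum>i<m. sin c + cos c * (x i - c))"
      using sin_le_tangent[of _ c] x c that by (intro sum_strict_mono_ex1) auto
    then show False using tot pad eq by linarith
  qed
  then show "m = N \<and> (\<forall>i<m. x i = pi / (2 * N))" using \<open>m = N\<close> by (simp add: c_def)
qed

text \<open>Intermediate value theorem in \<open>l\<close> on the interval from 0 to
  \<open>1 / M\<close>, with \<open>M\<close> the largest \<open>a i\<close>: the sum is 0 at the
  left end, and at the right end the term of the maximum alone is already
  \<open>pi / 2\<close>.\<close>

lemma ex_arcsin_scaling: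
  fixes a :: "nat \<Rightarrow> real"
  assumes a: "\<And>i. i < m \<Longrightarrow> a i > 0" and m: "m > 0"
  obtains l where "\<And>i. i < m \<Longrightarrow> 0 \<le> l * a i \<and> l * a i \<le> 1"
    "(\<Sum>i<m. arcsin (l * a i)) = pi / 2"
proof -
  define M where "M = Max (a ` {..<m})"
  have M: "a i \<le> M" if "i < m" for i using that by (simp add: M_def)
  have "M \<in> a ` {..<m}" unfolding M_def using m by (intro Max_in) auto
  then obtain k where k: "k < m" "M = a k" by auto
  have Mpos: "M > 0" using k a by simp
  have range: "0 \<le> l * a i \<and> l * a i \<le> 1" if "0 \<le> l" "l \<le> 1 / M" "i < m" for l i
  proof -
    have "l * a i \<le> (1 / M) * M" using that M a Mpos by (intro mult_mono) (auto intro: less_imp_le)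
    then show ?thesis using that a[of i] Mpos by (auto intro: less_imp_le)
  qed
  have "\<exists>l\<ge>0. l \<le> 1 / M \<and> (\<Sum>i<m. arcsin (l * a i)) = pi / 2"
  proof (rule IVT')
    have "arcsin (1 / M * a k) \<le> (\<Sum>i<m. arcsin (1 / M * a i))"
    proof (rule member_le_sum)
      show "0 \<le> arcsin (1 / M * a i)" if "i \<in> {..<m} - {k}" for i
        using range[of "1 / M" i] that Mpos by (intro arcsin_nonneg) auto
    qed (use k in auto)
    then show "pi / 2 \<le> (\<Sum>i<m. arcsin (1 / M * a i))" using k Mpos by simp
    show "continuous_on {0..1 / M} (\<lambda>l. \<Sum>i<m. arcsin (l * a i))"
    proof (intro continuous_intros ballI)
      fix i l assume "i \<in> {..<m}" "l \<in> {0..1 / M}"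
      then show "- 1 \<le> l * a i \<and> l * a i \<le> 1" using range[of l i] by auto
    qed
  qed (use Mpos in auto)
  then show ?thesis using range that by blast
qed

text \<open>One step of Jacobi's substitution \<open>u = f + p * c\<close>, where \<open>f\<close>
  and \<open>p\<close> solve the same second-order equation and \<open>r\<close>, \<open>s\<close>
  stand for \<open>1 / a i\<close>, \<open>1 / a (Suc i)\<close>. The two brackets are consecutive
  values of one sequence, so that after summation only its end values and the squares of differences
  of \<open>c\<close> are left.\<close>

lemma jacobi_telescope:
  fixes q r s :: real
  assumes "q * f1 = f0 * r + f2 * s" "q * p1 = p0 * r + p2 * s"
  shows "2 * (f0 + p0 * c0) * (f1 + p1 * c1) * r - q * (f1 + p1 * c1)\<^sup>2 =
    (f0 * f1 * r + 2 * p0 * c0 * f1 * r + p0 * p1 * c0\<^sup>2 * r)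
    - (f1 * f2 * s + 2 * p1 * c1 * f2 * s + p1 * p2 * c1\<^sup>2 * s) - p0 * p1 * r * (c0 - c1)\<^sup>2"
  using assms by algebra

lemma closed_polar_body: "closed (polar_body K)" for K :: "'b::real_inner set"
proof -
  have "polar_body K = (\<Inter>y\<in>K. {x. y \<bullet> x \<le> 1})" by (auto simp: polar_body_def inner_commute)
  then show ?thesis by (auto intro: closed_halfspace_le)
qed

lemma convex_polar_body: "convex (polar_body K)" for K :: "'b::real_inner set"
proof -
  have "polar_body K = (\<Inter>y\<in>K. {x. y \<bullet> x \<le> 1})" by (auto simp: polar_body_def inner_commute)
  then show ?thesis by (auto intro: convex_INT convex_halfspace_le)
qed

lemma zero_in_polar_body: "0 \<in> polar_body K"
  by (simp add: polar_body_def)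

section \<open>The discrete Hill equation and its quadratic form\<close>

text \<open>Convexity in terms of determinants: \<open>pos\<close> says that the vertices run
  counterclockwise through half a turn in \<open>m\<close> steps, and \<open>convex_position\<close>
  that the triangle \<open>v i\<close>, \<open>v k\<close>, \<open>v j\<close> has positive signed
  area. The case \<open>j = i + m\<close> is the one where the chord passes through the
  origin.\<close>

locale symmetric_polygon =
  fixes m :: nat and v :: "nat \<Rightarrow> real^2"
  assumes m_ge_2: "m \<ge> 2"
    and anti: "v (i + m) = - v i"
    and pos: "i < j \<Longrightarrow> j < i + m \<Longrightarrow> cr (v i) (v j) > 0"
    and convex_position: "i < k \<Longrightarrow> k < j \<Longrightarrow> j \<le> i + m \<Longrightarrow>
      cr (v i) (v k) + cr (v k) (v j) > cr (v i) (v j)"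
begin

sublocale symmetric_fan m v
  using m_ge_2 by unfold_locales (auto simp: anti pos)

abbreviation a :: "nat \<Rightarrow> real" where "a i \<equiv> cr (v i) (v (Suc i))"

text \<open>The potential of the discrete Hill equation
  \<open>f i / a i + f (i + 2) / a (i + 1) = q i * f (i + 1)\<close>, whose solutions are the linear functionals of
  the vertices. Note the index: \<open>q i\<close> belongs to the vertex \<open>i + 1\<close>.\<close>

definition q :: "nat \<Rightarrow> real"
  where "q i = cr (v i) (v (Suc (Suc i))) / (a i * a (Suc i))"

definition form :: "(nat \<Rightarrow> real) \<Rightarrow> real"
  where "form u = (\<Sum>i<m. 2 * u i * u (Suc i) / a i - q i * (u (Suc i))\<^sup>2)"

text \<open>The point of the polar body belonging to the edge from \<open>v i\<close> to
  \<open>v (Suc i)\<close>, obtained by turning the edge vector clockwise by a right angle and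
  scaling it so that the inner product with both endpoints is 1.\<close>

definition dual :: "nat \<Rightarrow> real^2"
  where "dual i = (1 / a i) *\<^sub>R vector [(v (Suc i) - v i)$2, - (v (Suc i) - v i)$1]"

lemma a_antiperiodic: "a (i + m) = a i"
  by (simp add: anti flip: add_Suc)

lemma hill: "q i *\<^sub>R v (Suc i) = (1 / a i) *\<^sub>R v i + (1 / a (Suc i)) *\<^sub>R v (Suc (Suc i))"
proof -
  have "q i *\<^sub>R v (Suc i) = (1 / (a i * a (Suc i))) *\<^sub>R (cr (v i) (v (Suc (Suc i))) *\<^sub>R v (Suc i))"
    by (simp add: q_def)
  also have "\<dots> = (1 / a i) *\<^sub>R v i + (1 / a (Suc i)) *\<^sub>R v (Suc (Suc i))"
    unfolding cramer[of "v i" "v (Suc (Suc i))"]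
    using consecutive_pos[of i] consecutive_pos[of "Suc i"] by (simp add: scaleR_add_right)
  finally show ?thesis .
qed

lemma hill_inner: "q i * (d \<bullet> v (Suc i)) = (d \<bullet> v i) * (1 / a i) + (d \<bullet> v (Suc (Suc i))) * (1 / a (Suc i))"
  using arg_cong[OF hill[of i], of "\<lambda>x. d \<bullet> x"] by (simp add: inner_add_right)

text \<open>The form is negative semidefinite on antiperiodic sequences: subtracting a solution of the
  Hill equation makes the sequence vanish at \<open>0\<close> and \<open>m\<close>, where Jacobi's substitution by the
  positive solution \<open>cr (v 0) (v i)\<close> applies.\<close>

lemma form_decomposition:
  assumes u: "u m = - u 0"
  obtains d c where "\<And>i. i \<le> m \<Longrightarrow> u i = d \<bullet> v i + cr (v 0) (v i) * c i"
    "form u = - (\<Sum>i<m. cr (v 0) (v i) * cr (v 0) (v (Suc i)) / a i * (c i - c (Suc i))\<^sup>2)"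
proof -
  \<comment> \<open>The functional \<open>d\<close> agrees with \<open>u\<close> at 0, hence by
    antiperiodicity also at \<open>m\<close>.\<close>
  define d where "d = (u 0 / (v 0 \<bullet> v 0)) *\<^sub>R v 0"
  \<comment> \<open>At \<open>i = 0\<close> and \<open>i = m\<close> the denominator
    \<open>p i\<close> vanishes and \<open>c i\<close> is 0 by convention; there
    \<open>u i = f i\<close>, so the decomposition still holds.\<close>
  define f p c where "f i = d \<bullet> v i" and "p i = cr (v 0) (v i)"
    and "c i = (u i - f i) / p i" for i
  have f0: "f 0 = u 0" using nonzero[of 0] by (simp add: f_def d_def)
  have fm: "f (i + m) = - f i" for i by (simp add: f_def anti)
  have p0: "p 0 = 0" by (simp add: p_def)
  have pm: "p m = 0" using anti[of 0] by (simp add: p_def)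
  have ueq: "u i = f i + p i * c i" if "i \<le> m" for i
  proof (cases "i = 0 \<or> i = m")
    case True
    then show ?thesis using f0 p0 pm fm[of 0] u by auto
  next
    case False
    then have "p i > 0" using pos[of 0 i] that by (simp add: p_def)
    then show ?thesis by (simp add: c_def)
  qed
  have hf: "q i * f (Suc i) = f i * (1 / a i) + f (Suc (Suc i)) * (1 / a (Suc i))" for i
    unfolding f_def by (rule hill_inner)
  have hp: "q i * p (Suc i) = p i * (1 / a i) + p (Suc (Suc i)) * (1 / a (Suc i))" for i
    using hill_inner[of i "vector [- v 0 $ 2, v 0 $ 1]"] by (simp add: p_def inner_minus_perp)
  define G where "G i = f i * f (Suc i) * (1 / a i) + 2 * p i * c i * f (Suc i) * (1 / a i)
    + p i * p (Suc i) * (c i)\<^sup>2 * (1 / a i)" for i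
  have "form u = (\<Sum>i<m. (G i - G (Suc i)) - p i * p (Suc i) / a i * (c i - c (Suc i))\<^sup>2)"
    unfolding form_def
  proof (intro sum.cong refl)
    fix i assume "i \<in> {..<m}"
    then have *: "u i = f i + p i * c i" "u (Suc i) = f (Suc i) + p (Suc i) * c (Suc i)"
      using ueq[of i] ueq[of "Suc i"] by auto
    show "2 * u i * u (Suc i) / a i - q i * (u (Suc i))\<^sup>2 =
      (G i - G (Suc i)) - p i * p (Suc i) / a i * (c i - c (Suc i))\<^sup>2"
      using jacobi_telescope[OF hf hp, of i "c i" "c (Suc i)"] unfolding * G_def by simp
  qed
  also have "\<dots> = G 0 - G m - (\<Sum>i<m. p i * p (Suc i) / a i * (c i - c (Suc i))\<^sup>2)"
    by (simp only: sum_subtractf[of "\<lambda>i. G i - G (Suc i)"] sum_lessThan_telescope')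
  \<comment> \<open>Since \<open>p\<close> vanishes at both ends, only the product of two values of
    \<open>f\<close> remains in \<open>G\<close>, and its two sign changes cancel.\<close>
  also have "G m = G 0"
    using fm[of 0] fm[of 1] a_antiperiodic[of 0] by (simp add: G_def p0 pm)
  finally show ?thesis using that[of d c] ueq by (auto simp: f_def p_def)
qed

lemma p_nonneg: "i \<le> m \<Longrightarrow> cr (v 0) (v i) \<ge> 0"
  using pos[of 0 i] anti[of 0] by (cases "i = 0 \<or> i = m") (auto intro: less_imp_le)

lemma form_nonpos:
  assumes u: "u m = - u 0" shows "form u \<le> 0"
proof -
  obtain d c where
    "form u = - (\<Sum>i<m. cr (v 0) (v i) * cr (v 0) (v (Suc i)) / a i * (c i - c (Suc i))\<^sup>2)"
    using form_decomposition[OF u] by blast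
  moreover have "(\<Sum>i<m. cr (v 0) (v i) * cr (v 0) (v (Suc i)) / a i * (c i - c (Suc i))\<^sup>2) \<ge> 0"
    using p_nonneg by (intro sum_nonneg mult_nonneg_nonneg divide_nonneg_pos consecutive_pos) auto
  ultimately show ?thesis by simp
qed

text \<open>All weights with \<open>0 < i\<close> and \<open>Suc i < m\<close> are positive, so
  \<open>c\<close> is constant on the interior indices. At the ends \<open>p\<close> vanishes, so
  \<open>u\<close> is everywhere the sum of \<open>d\<close> and a fixed multiple of the functional
  \<open>cr (v 0)\<close>.\<close>

lemma form_eq_0:
  assumes u: "u m = - u 0" and "form u = 0"
  obtains d where "\<And>i. i \<le> m \<Longrightarrow> u i = d \<bullet> v i"
proof -
  obtain d c where ueq: "\<And>i. i \<le> m \<Longrightarrow> u i = d \<bullet> v i + cr (v 0) (v i) * c i" and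
    form: "form u = - (\<Sum>i<m. cr (v 0) (v i) * cr (v 0) (v (Suc i)) / a i * (c i - c (Suc i))\<^sup>2)"
    using form_decomposition[OF u] by blast
  let ?g = "\<lambda>i. cr (v 0) (v i) * cr (v 0) (v (Suc i)) / a i * (c i - c (Suc i))\<^sup>2"
  have "(\<Sum>i<m. ?g i) = 0" using form \<open>form u = 0\<close> by simp
  moreover have "?g i \<ge> 0" if "i < m" for i
    using that p_nonneg by (intro mult_nonneg_nonneg divide_nonneg_pos consecutive_pos) auto
  ultimately have g: "?g i = 0" if "i < m" for i
    using that sum_nonneg_eq_0_iff[of "{..<m}" ?g] by auto
  have step: "c (Suc i) = c i" if "0 < i" "Suc i < m" for i
    using g[of i] pos[of 0 i] pos[of 0 "Suc i"] consecutive_pos[of i] that by simp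
  have c: "c (Suc i) = c 1" if "Suc i < m" for i
    using that by (induction i) (auto simp: step)
  have "u i = (d + c 1 *\<^sub>R vector [- v 0 $ 2, v 0 $ 1]) \<bullet> v i" if "i \<le> m" for i
  proof (cases "i = 0 \<or> i = m")
    case True
    then have "cr (v 0) (v i) = 0" using anti[of 0] by auto
    then show ?thesis using ueq[OF that] by (simp add: inner_add_left inner_minus_perp)
  next
    case False
    then have "c i = c 1" using c[of "i - 1"] that by simp
    then show ?thesis using ueq[OF that] by (simp add: inner_add_left inner_minus_perp)
  qed
  then show ?thesis by (rule that)
qed

section \<open>The dual vertices\<close>

lemma dual_antiperiodic: "dual (i + m) = - dual i"
proof -
  have "v (Suc (i + m)) = - v (Suc i)" using anti[of "Suc i"] by simp
  then have "dual (i + m) = (1 / a i) *\<^sub>R vector [(- v (Suc i) + v i)$2, - (- v (Suc i) + v i)$1]"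
    by (simp add: dual_def anti)
  then show ?thesis by (simp add: dual_def vec2_eq_iff diff_divide_distrib)
qed

lemma inner_dual: "dual i \<bullet> x = (cr x (v (Suc i)) + cr (v i) x) / a i"
  by (simp add: dual_def inner_vec2 cr_def add_divide_distrib diff_divide_distrib algebra_simps)

lemma inner_dual_self [simp]: "dual i \<bullet> v i = 1" "dual i \<bullet> v (Suc i) = 1"
  using consecutive_pos[of i] by (simp_all add: inner_dual)

lemma cr_dual: "cr (dual i) (dual (Suc i)) = 1 / a i + 1 / a (Suc i) - q i"
proof -
  have "cr (dual i) (dual (Suc i)) =
      (a i + a (Suc i) - cr (v i) (v (Suc (Suc i)))) / (a i * a (Suc i))"
    unfolding dual_def by (simp add: cr_def) algebra
  also have "\<dots> = 1 / a i + 1 / a (Suc i) - q i"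
    using consecutive_pos[of i] consecutive_pos[of "Suc i"]
    by (simp add: q_def diff_divide_distrib add_divide_distrib)
  finally show ?thesis .
qed

text \<open>The determinant of consecutive dual vertices is twice the area of the triangle
  \<open>v i\<close>, \<open>v (i + 1)\<close>, \<open>v (i + 2)\<close> divided by
  \<open>a i * a (i + 1)\<close>. The lemmas on fans thus apply to the polar body as well.\<close>

sublocale dual: symmetric_fan m dual
proof
  fix i
  have "cr (dual i) (dual (Suc i)) =
      (a i + a (Suc i) - cr (v i) (v (Suc (Suc i)))) / (a i * a (Suc i))"
    using consecutive_pos[of i] consecutive_pos[of "Suc i"]
    by (simp add: cr_dual q_def diff_divide_distrib add_divide_distrib)
  also have "\<dots> > 0"
    using consecutive_pos[of i] consecutive_pos[of "Suc i"] convex_position[of i "Suc i" "Suc (Suc i)"] m_ge_2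
    by simp
  finally show "cr (dual i) (dual (Suc i)) > 0" .
qed (rule dual_antiperiodic)

text \<open>Every edge line supports the polygon. In the half turn after the edge this is convex
  position of \<open>i\<close>, \<open>Suc i\<close>, \<open>j\<close>; in the other half it is that
  of \<open>j\<close>, \<open>i + 2 * m\<close>, \<open>Suc i + 2 * m\<close>.\<close>

lemma inner_dual_le: "dual i \<bullet> v j \<le> 1"
proof -
  have main: "dual i \<bullet> v j \<le> 1" if "i \<le> j" "j < i + 2 * m" for j
  proof -
    have "j = i \<or> j = Suc i \<or> Suc i < j \<and> j \<le> i + m \<or> i + m < j"
      using that by arith
    then consider "j = i" | "j = Suc i" | "Suc i < j" "j \<le> i + m" | "i + m < j"
      by blast
    then show ?thesis
    proof cases
      case 3
      then show ?thesis
        using convex_position[of i "Suc i" j] consecutive_pos[of i] cr_anticomm[of "v j" "v (Suc i)"]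
        by (simp add: inner_dual)
    next
      case 4
      then show ?thesis
        using convex_position[of j "i + 2 * m" "Suc i + 2 * m"] consecutive_pos[of i] that
        unfolding periodic using cr_anticomm[of "v j" "v i"]
        by (simp add: inner_dual)
    qed auto
  qed
  \<comment> \<open>The representative of \<open>j\<close> modulo \<open>2 * m\<close> in the period
    starting at \<open>i\<close>. Adding \<open>2 * m * i\<close> first keeps the subtraction of
    \<open>i\<close> from being truncated.\<close>
  define k where "k = i + (j + 2 * m * i - i) mod (2 * m)"
  have "v (j + 2 * m * i) = v k"
  proof -
    have "i \<le> j + 2 * m * i" using m_pos by (simp add: trans_le_add2)
    then have "j + 2 * m * i = k + ((j + 2 * m * i - i) div (2 * m)) * (2 * m)"
      unfolding k_def using div_mult_mod_eq[of "j + 2 * m * i - i" "2 * m"] by linarith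
    moreover have "v (k + l * (2 * m)) = v k" for l
      using periodic by (induction l) (simp_all, metis add.assoc add.commute)
    ultimately show ?thesis by metis
  qed
  moreover have "v (j + 2 * m * l) = v j" for l
    using periodic[of "j + 2 * m * _"] by (induction l) (simp_all add: algebra_simps)
  ultimately have "v j = v k" by simp
  moreover have "i \<le> k" "k < i + 2 * m" using m_pos by (simp_all add: k_def)
  ultimately show ?thesis using main[of k] by simp
qed

section \<open>The bound for the product of the two sums, with equality\<close>

text \<open>Adding the cosine and sine forms termwise, the mixed products combine to
  \<open>cos (2 * x i) = 1 - 2 * (sin (x i))\<^sup>2\<close> and the squares to 1. An index shift
  over one period turns the sum of \<open>cr_dual\<close> into that of
  \<open>2 / a i - q i\<close>.\<close>

lemma sum_dual_eq:
  assumes x: "(\<Sum>i<m. x i) = pi / 2"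
  defines "\<phi> \<equiv> \<lambda>i. 2 * (\<Sum>j<i. x j)"
  shows "(\<Sum>i<m. cr (dual i) (dual (Suc i))) =
      (\<Sum>i<m. 4 * (sin (x i))\<^sup>2 / a i) + form (\<lambda>i. cos (\<phi> i)) + form (\<lambda>i. sin (\<phi> i))"
proof -
  have shift: "(\<Sum>i<m. 1 / a (Suc i)) = (\<Sum>i<m. 1 / a i)"
    using sum.lessThan_Suc_shift[of "\<lambda>i. 1 / a i" m] sum.lessThan_Suc[of "\<lambda>i. 1 / a i" m]
      a_antiperiodic[of 0] by simp
  have step: "2 * cos (\<phi> i) * cos (\<phi> (Suc i)) / a i - q i * (cos (\<phi> (Suc i)))\<^sup>2
      + (2 * sin (\<phi> i) * sin (\<phi> (Suc i)) / a i - q i * (sin (\<phi> (Suc i)))\<^sup>2)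
      = 2 / a i - q i - 4 * (sin (x i))\<^sup>2 / a i" for i
  proof -
    have "cos (\<phi> i) * cos (\<phi> (Suc i)) + sin (\<phi> i) * sin (\<phi> (Suc i)) = cos (2 * x i)"
      using cos_diff[of "\<phi> (Suc i)" "\<phi> i"] by (simp add: \<phi>_def algebra_simps)
    also have "\<dots> = 1 - 2 * (sin (x i))\<^sup>2"
      using cos_double_sin[of "x i"] by simp
    finally have "(cos (\<phi> i) * cos (\<phi> (Suc i)) + sin (\<phi> i) * sin (\<phi> (Suc i))) * (2 / a i)
        = (1 - 2 * (sin (x i))\<^sup>2) * (2 / a i)" by simp
    moreover have "q i * (cos (\<phi> (Suc i)))\<^sup>2 + q i * (sin (\<phi> (Suc i)))\<^sup>2 = q i"
      by (simp flip: distrib_left)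
    ultimately show ?thesis by (simp add: algebra_simps add_divide_distrib diff_divide_distrib)
  qed
  have "form (\<lambda>i. cos (\<phi> i)) + form (\<lambda>i. sin (\<phi> i)) = (\<Sum>i<m. 2 / a i - q i - 4 * (sin (x i))\<^sup>2 / a i)"
    unfolding form_def sum.distrib[symmetric] step ..
  moreover have "(\<Sum>i<m. cr (dual i) (dual (Suc i))) = (\<Sum>i<m. 2 / a i - q i)"
    using shift by (simp add: cr_dual sum.distrib sum_subtractf flip: sum_distrib_left) 
      (simp add: sum_distrib_left)
  ultimately show ?thesis by (simp add: sum_subtractf)
qed

lemma area_product:
  fixes N :: nat
  assumes N: "m \<le> N"
  defines "P \<equiv> (\<Sum>i<m. a i) * (\<Sum>i<m. cr (dual i) (dual (Suc i)))"
  shows "P \<le> 4 * (N * sin (pi / (2 * N)))\<^sup>2"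
    and "P = 4 * (N * sin (pi / (2 * N)))\<^sup>2 \<Longrightarrow>
      m = N \<and> (\<exists>d e. \<forall>i. cos (i * pi / m) = d \<bullet> v i \<and> sin (i * pi / m) = e \<bullet> v i)"
proof -
  obtain l where l: "\<And>i. i < m \<Longrightarrow> 0 \<le> l * a i \<and> l * a i \<le> 1" "(\<Sum>i<m. arcsin (l * a i)) = pi / 2"
    using ex_arcsin_scaling[of m a] consecutive_pos m_pos by blast
  define x where "x i = arcsin (l * a i)" for i
  define \<phi> where "\<phi> i = 2 * (\<Sum>j<i. x j)" for i
  have x: "0 \<le> x i \<and> x i \<le> pi / 2" if "i < m" for i
    using l(1)[OF that] arcsin_ubound[of "l * a i"] by (auto simp: x_def intro: arcsin_nonneg)
  have sx: "sin (x i) = l * a i" if "i < m" for i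
    using l(1)[OF that] by (simp add: x_def)
  have sum_x: "(\<Sum>i<m. x i) = pi / 2" using l by (simp add: x_def)
  define S where "S = (\<Sum>i<m. sin (x i))"
  have S: "S = l * (\<Sum>i<m. a i)" by (simp add: S_def sx sum_distrib_left)
  have apos: "(\<Sum>i<m. a i) > 0" using consecutive_pos m_pos by (intro sum_pos) auto
  \<comment> \<open>Because the sines are proportional to the \<open>a i\<close>, the product of
    this sum with that of the \<open>a i\<close> is exactly \<open>4 * S\<^sup>2\<close>.\<close>
  have "(\<Sum>i<m. 4 * (sin (x i))\<^sup>2 / a i) = (\<Sum>i<m. 4 * l\<^sup>2 * a i)"
  proof (intro sum.cong refl)
    fix i assume "i \<in> {..<m}"
    then show "4 * (sin (x i))\<^sup>2 / a i = 4 * l\<^sup>2 * a i"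
      using consecutive_pos[of i] by (simp add: sx power2_eq_square)
  qed
  then have "(\<Sum>i<m. a i) * (\<Sum>i<m. 4 * (sin (x i))\<^sup>2 / a i) = 4 * S\<^sup>2"
    by (simp add: S power2_eq_square flip: sum_distrib_left)
  then have P: "P = 4 * S\<^sup>2 + (\<Sum>i<m. a i) * (form (\<lambda>i. cos (\<phi> i)) + form (\<lambda>i. sin (\<phi> i)))"
    unfolding P_def sum_dual_eq[OF sum_x] by (simp add: \<phi>_def algebra_simps)
  \<comment> \<open>The doubled angles add up to \<open>pi\<close>, which makes both test sequences
    antiperiodic.\<close>
  have ends: "cos (\<phi> m) = - cos (\<phi> 0)" "sin (\<phi> m) = - sin (\<phi> 0)"
  proof -
    have "\<phi> m = pi" "\<phi> 0 = 0" using sum_x by (simp_all add: \<phi>_def)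
    then show "cos (\<phi> m) = - cos (\<phi> 0)" "sin (\<phi> m) = - sin (\<phi> 0)" by simp_all
  qed
  have nonpos: "form (\<lambda>i. cos (\<phi> i)) \<le> 0" "form (\<lambda>i. sin (\<phi> i)) \<le> 0"
    using ends by (auto intro: form_nonpos)
  have N0: "N > 0" using N m_pos by simp
  have "S \<ge> 0" using l(1) by (auto simp: S_def sx intro!: sum_nonneg)
  have SN: "S \<le> N * sin (pi / (2 * N))"
    unfolding S_def using x sum_x N N0 by (rule sum_sin_le(1))
  have sq: "S\<^sup>2 \<le> (N * sin (pi / (2 * N)))\<^sup>2"
    using SN \<open>S \<ge> 0\<close> by (rule power_mono)
  have neg: "(\<Sum>i<m. a i) * (form (\<lambda>i. cos (\<phi> i)) + form (\<lambda>i. sin (\<phi> i))) \<le> 0"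
    using apos nonpos by (intro mult_nonneg_nonpos) auto
  show "P \<le> 4 * (N * sin (pi / (2 * N)))\<^sup>2" using P sq neg by linarith
  \<comment> \<open>Both estimates are now tight: that for \<open>S\<close> fixes \<open>m\<close>
    and all angles, and the vanishing of both forms makes the test sequences functionals of the
    vertices.\<close>
  assume eq: "P = 4 * (N * sin (pi / (2 * N)))\<^sup>2"
  then have "S\<^sup>2 = (N * sin (pi / (2 * N)))\<^sup>2" using P sq neg by linarith
  then have "S = N * sin (pi / (2 * N))"
    using SN \<open>S \<ge> 0\<close> by (simp add: power2_eq_iff_nonneg)
  then have mN: "m = N" and xi: "x i = pi / (2 * N)" if "i < m" for i
    using sum_sin_le(2)[OF x sum_x N N0] that m_pos by (auto simp: S_def)
  have "m = N" using mN[of 0] m_pos by simp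
  have "(\<Sum>i<m. a i) * (form (\<lambda>i. cos (\<phi> i)) + form (\<lambda>i. sin (\<phi> i))) = 0"
    using P eq sq neg by linarith
  then have "form (\<lambda>i. cos (\<phi> i)) + form (\<lambda>i. sin (\<phi> i)) = 0" using apos by simp
  then have "form (\<lambda>i. cos (\<phi> i)) = 0" "form (\<lambda>i. sin (\<phi> i)) = 0"
    using nonpos by linarith+
  then obtain d e where de: "\<And>i. i \<le> m \<Longrightarrow> cos (\<phi> i) = d \<bullet> v i" "\<And>i. i \<le> m \<Longrightarrow> sin (\<phi> i) = e \<bullet> v i"
    using form_eq_0[of "\<lambda>i. cos (\<phi> i)"] form_eq_0[of "\<lambda>i. sin (\<phi> i)"] ends by metis
  have "\<phi> i = i * pi / m" if "i \<le> m" for i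
  proof -
    have "(\<Sum>j<i. x j) = (\<Sum>j<i. pi / (2 * m))"
      using that xi \<open>m = N\<close> by (intro sum.cong) auto
    then show ?thesis by (simp add: \<phi>_def)
  qed
  then have base: "cos (i * pi / m) = d \<bullet> v i \<and> sin (i * pi / m) = e \<bullet> v i" if "i \<le> m" for i
    using de that by simp
  have "cos (i * pi / m) = d \<bullet> v i \<and> sin (i * pi / m) = e \<bullet> v i" for i
  proof (induction i rule: less_induct)
    case (less i)
    show ?case
    proof (cases "i \<le> m")
      case False
      define k where "k = i - m"
      have i: "i = k + m" "k < i" using False m_pos by (auto simp: k_def)
      have "i * pi / m = k * pi / m + pi" using m_pos by (simp add: i field_simps)
      then show ?thesis using less.IH[OF i(2)] anti[of k] by (simp add: i(1)[symmetric])
    qed (use base in simp)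
  qed
  then show "m = N \<and> (\<exists>d e. \<forall>i. cos (i * pi / m) = d \<bullet> v i \<and> sin (i * pi / m) = e \<bullet> v i)"
    using \<open>m = N\<close> by blast
qed

section \<open>Areas of the polygon and of its polar body\<close>

lemma inner_dual_hull:
  assumes "x \<in> convex hull (v ` {..<2*m})" shows "dual i \<bullet> x \<le> 1"
proof -
  have "convex hull (v ` {..<2*m}) \<subseteq> {x. dual i \<bullet> x \<le> 1}"
    by (intro hull_minimal convex_halfspace_le) (auto simp: inner_dual_le)
  then show ?thesis using assms by auto
qed

lemma area_le: "measure lebesgue (convex hull (v ` {..<2*m})) \<le> (\<Sum>i<m. a i)"
  by (rule measure_le[where g = dual])
    (auto simp: inner_dual_hull compact_imp_closed finite_imp_compact_convex_hull)

lemma v_in_hull: "v i \<in> convex hull (v ` {..<2*m})"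
proof -
  have "v i = v (i mod (2 * m))"
  proof (induction i rule: less_induct)
    case (less i)
    show ?case
    proof (cases "i < 2 * m")
      case False
      then show ?thesis using less[of "i - 2 * m"] periodic[of "i - 2 * m"] m_pos
        by (simp add: le_mod_geq)
    qed simp
  qed
  then show ?thesis using m_pos by (metis hull_inc imageI lessThan_iff mod_less_divisor mult_pos_pos zero_less_numeral)
qed

lemma zero_in_hull: "0 \<in> convex hull (v ` {..<2*m})"
proof -
  have "(1/2) *\<^sub>R v 0 + (1/2) *\<^sub>R v m \<in> convex hull (v ` {..<2*m})"
    by (rule convexD) (auto simp: v_in_hull)
  then show ?thesis using anti[of 0] by simp
qed

lemma area_eq: "measure lebesgue (convex hull (v ` {..<2*m})) = (\<Sum>i<m. a i)"
  by (rule measure_eq[where g = dual]) (auto simp: pos zero_in_hull v_in_hull inner_dual_hull)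

lemma inner_polar:
  "x \<in> polar_body (convex hull (v ` {..<2*m})) \<Longrightarrow> v i \<bullet> x \<le> 1"
  using v_in_hull[of i] by (auto simp: polar_body_def inner_commute)

text \<open>The vectors \<open>dual i\<close> and \<open>dual (Suc i)\<close> both have inner
  product 1 with the common vertex \<open>v (Suc i)\<close>, which therefore is the edge functional
  of index \<open>i\<close> for the dual fan.\<close>

lemma polar_area_le:
  "measure lebesgue (polar_body (convex hull (v ` {..<2*m}))) \<le> (\<Sum>i<m. cr (dual i) (dual (Suc i)))"
  by (rule dual.measure_le[where g = "\<lambda>i. v (Suc i)"])
    (auto simp: closed_polar_body inner_polar inner_commute[of "v _" "dual _"])

lemma polar_lmeasurable: "polar_body (convex hull (v ` {..<2*m})) \<in> lmeasurable"
  by (rule dual.lmeasurable[where g = "\<lambda>i. v (Suc i)"])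
    (auto simp: closed_polar_body inner_polar inner_commute[of "v _" "dual _"])

lemma polar_area_eq:
  assumes "\<And>i j. i < j \<Longrightarrow> j < i + m \<Longrightarrow> cr (dual i) (dual j) > 0"
  shows "measure lebesgue (polar_body (convex hull (v ` {..<2*m}))) = (\<Sum>i<m. cr (dual i) (dual (Suc i)))"
proof (rule dual.measure_eq[where g = "\<lambda>i. v (Suc i)"])
  show "dual i \<in> polar_body (convex hull (v ` {..<2*m}))" for i
    by (simp add: polar_body_def inner_dual_hull)
qed (auto simp: assms convex_polar_body zero_in_polar_body inner_polar inner_commute[of "v _" "dual _"])

end

section \<open>Enumerating the vertices of a symmetric polygon by angle\<close>

definition udir :: "real \<Rightarrow> real^2" where "udir t = vector [cos t, sin t]"

lemma cr_udir: "cr (udir s) (udir t) = sin (t - s)"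
  by (simp add: cr_def udir_def sin_diff algebra_simps)

lemma uminus_mem_o_symmetric: "o_symmetric K \<Longrightarrow> x \<in> K \<Longrightarrow> - x \<in> K"
  unfolding o_symmetric_def by (metis image_eqI)

lemma extreme_point_of_uminus:
  assumes "o_symmetric K" "x extreme_point_of K"
  shows "- x extreme_point_of K"
  unfolding extreme_point_of_def
proof (intro conjI ballI notI)
  show "- x \<in> K"
    using assms uminus_mem_o_symmetric by (auto simp: extreme_point_of_def)
  fix a b assume "a \<in> K" "b \<in> K" "- x \<in> open_segment a b"
  then obtain u where u: "a \<noteq> b" "0 < u" "u < 1" "- x = (1 - u) *\<^sub>R a + u *\<^sub>R b"
    by (auto simp: in_segment)
  have "x = (1 - u) *\<^sub>R (- a) + u *\<^sub>R (- b)"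
    using u(4) by (metis add.inverse_inverse minus_add_distrib scaleR_minus_right)
  then have "x \<in> open_segment (- a) (- b)" using u by (auto simp: in_segment)
  then show False
    using assms uminus_mem_o_symmetric[OF assms(1)] \<open>a \<in> K\<close> \<open>b \<in> K\<close>
    by (auto simp: extreme_point_of_def)
qed

text \<open>On this half-open half plane, which contains exactly one of \<open>x\<close> and
  \<open>- x\<close> for nonzero \<open>x\<close>, the arccosine alone determines the polar
  angle.\<close>

lemma polar_form:
  fixes x :: "real^2"
  assumes x: "x$2 > 0 \<or> x$2 = 0 \<and> x$1 > 0"
  defines "t \<equiv> arccos (x$1 / norm x)"
  shows "0 \<le> t" "t < pi" "norm x *\<^sub>R udir t = x"
proof -
  have nz: "norm x > 0" using x by auto
  have n2: "(norm x)\<^sup>2 = (x$1)\<^sup>2 + (x$2)\<^sup>2"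
    unfolding power2_norm_eq_inner inner_vec2 by (simp add: power2_eq_square)
  have "\<bar>x$1\<bar> \<le> norm x" by (rule component_le_norm_cart)
  then have le: "- 1 \<le> x$1 / norm x" "x$1 / norm x \<le> 1"
    using nz by (auto simp: field_simps abs_le_iff)
  show t0: "0 \<le> t" unfolding t_def by (rule arccos_lbound[OF le])
  have tpi: "t \<le> pi" unfolding t_def by (rule arccos_ubound[OF le])
  have cos: "cos t = x$1 / norm x" unfolding t_def by (rule cos_arccos[OF le])
  have "(sin t)\<^sup>2 = (x$2 / norm x)\<^sup>2"
    using nz unfolding sin_squared_eq cos
    by (simp add: power_divide divide_simps) (simp add: n2)
  moreover have "sin t \<ge> 0" using t0 tpi by (rule sin_ge_zero)
  moreover have "x$2 / norm x \<ge> 0" using x by auto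
  ultimately have sin: "sin t = x$2 / norm x" by (simp add: power2_eq_iff_nonneg)
  show "norm x *\<^sub>R udir t = x"
    using nz by (simp add: vec2_eq_iff udir_def cos sin)
  have "t \<noteq> pi"
  proof
    assume "t = pi"
    then have "x$2 = 0" "x$1 = - norm x" using cos sin nz by (auto simp: field_simps)
    then show False using x nz by linarith
  qed
  then show "t < pi" using tpi by simp
qed

text \<open>The vertices in the half-open upper half plane, sorted by angle, give \<open>v 0\<close>
  to \<open>v (m - 1)\<close>; the others are their negatives. Extremality of the vertices yields
  both distinct angles and convex position.\<close>

lemma ex_symmetric_polygon:
  assumes K: "convex_polygon K" "o_symmetric K"
  obtains m v where "symmetric_polygon m v" "2 * m = card (vertices K)" "K = convex hull (v ` {..<2*m})"
proof -
  define V where "V = vertices K"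
  have poly: "polytope K" and int: "interior K \<noteq> {}" using K by (auto simp: convex_polygon_def)
  have conv: "convex K" and comp: "compact K"
    using poly by (auto simp: polytope_imp_convex polytope_imp_compact)
  have hull: "K = convex hull V"
    unfolding V_def vertices_def by (rule Krein_Milman_Minkowski[OF comp conv])
  have finV: "finite V"
    unfolding V_def vertices_def
    using poly by (intro finite_polyhedron_extreme_points polytope_imp_polyhedron)
  have ext: "x extreme_point_of K" if "x \<in> V" for x using that by (simp add: V_def vertices_def)
  have VK: "x \<in> K" if "x \<in> V" for x using ext[OF that] by (simp add: extreme_point_of_def)
  have neg: "- x \<in> V" if "x \<in> V" for x
    using that extreme_point_of_uminus[OF K(2)] by (simp add: V_def vertices_def)
  \<comment> \<open>A nonzero point \<open>y\<close> exhibits the origin as the midpoint of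
    \<open>y\<close> and \<open>- y\<close>: it lies in \<open>K\<close> but is no vertex.\<close>
  obtain y where y: "y \<in> K" "y \<noteq> 0"
  proof -
    have "\<not> K \<subseteq> {0}" using int interior_mono[of K "{0}"] by auto
    then show ?thesis using that by auto
  qed
  have "y \<noteq> - y" using y by (auto simp: vec2_eq_iff)
  then have mid: "0 \<in> open_segment y (- y)"
    using y \<open>y \<noteq> - y\<close> by (auto simp: in_segment intro!: exI[of _ "1/2"] simp flip: scaleR_add_right)
  then have "0 \<in> K" using y uminus_mem_o_symmetric[OF K(2)] conv
    by (metis closed_segment_subset segment_open_subset_closed subsetD)
  have "0 \<notin> V" using ext[of 0] mid y uminus_mem_o_symmetric[OF K(2)] by (auto simp: extreme_point_of_def)

  define upper :: "real^2 \<Rightarrow> bool" where "upper x \<longleftrightarrow> x$2 > 0 \<or> x$2 = 0 \<and> x$1 > 0" for x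
  define U where "U = {x \<in> V. upper x}"
  define t where "t x = arccos (x$1 / norm x)" for x :: "real^2"
  have pf: "0 \<le> t x" "t x < pi" "norm x *\<^sub>R udir (t x) = x" if "x \<in> U" for x
    using polar_form[of x] that unfolding U_def upper_def t_def mem_Collect_eq by blast+
  have Unz: "norm x > 0" if "x \<in> U" for x using that by (auto simp: U_def upper_def)
  have V_eq: "V = U \<union> uminus ` U"
  proof (intro equalityI subsetI)
    fix x assume "x \<in> V"
    then have "x \<noteq> 0" using \<open>0 \<notin> V\<close> by auto
    then have "upper x \<or> upper (- x)" by (auto simp: upper_def vec2_eq_iff)
    then have "x \<in> U \<or> - x \<in> U" using \<open>x \<in> V\<close> neg by (auto simp: U_def)
    then show "x \<in> U \<union> uminus ` U" by (metis UnCI image_eqI minus_minus)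
  qed (use neg in \<open>auto simp: U_def\<close>)
  have finU: "finite U" using finV by (simp add: U_def)
  \<comment> \<open>Of two vertices on one ray the shorter would lie inside the segment from the
    origin to the longer.\<close>
  have same: "False" if "x \<in> U" "y \<in> U" "t x = t y" "norm x < norm y" for x y
  proof -
    define s where "s = norm x / norm y"
    have "x = s *\<^sub>R y"
    proof -
      have "x = norm x *\<^sub>R udir (t y)" using pf(3)[of x] that by simp
      also have "\<dots> = s *\<^sub>R (norm y *\<^sub>R udir (t y))" using Unz[of y] that by (simp add: s_def)
      also have "\<dots> = s *\<^sub>R y" using pf(3)[of y] that by simp
      finally show ?thesis .
    qed
    moreover have "0 < s" "s < 1" using that Unz by (auto simp: s_def)
    ultimately have "x \<in> open_segment 0 y" using that Unz[of y] by (auto simp: in_segment)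
    then show False using ext[of x] VK[of y] \<open>0 \<in> K\<close> that by (auto simp: U_def extreme_point_of_def)
  qed
  have inj: "inj_on t U"
  proof (rule inj_onI)
    fix x y assume *: "x \<in> U" "y \<in> U" "t x = t y"
    then have "norm x = norm y" using same[of x y] same[of y x] by (cases rule: linorder_cases[of "norm x" "norm y"]) auto
    then have "norm x *\<^sub>R udir (t x) = norm y *\<^sub>R udir (t y)" by (simp only: *(3))
    then show "x = y" unfolding pf(3)[OF *(1)] pf(3)[OF *(2)] .
  qed
  define m where "m = card U"
  have cardV: "card V = 2 * m"
  proof -
    have "U \<inter> uminus ` U = {}" by (auto simp: U_def upper_def)
    moreover have "card (uminus ` U) = m" unfolding m_def by (rule card_image) (auto intro: inj_onI)
    ultimately show ?thesis unfolding V_eq using finU by (subst card_Un_disjoint) (auto simp: m_def)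
  qed
  have m2: "m \<ge> 2"
  proof (rule ccontr)
    assume "\<not> m \<ge> 2"
    then have "card V \<le> DIM(real^2)" using cardV by simp
    then show False using empty_interior_convex_hull[OF finV] int hull by simp
  qed
  define xs where "xs = sorted_list_of_set (t ` U)"
  have xs: "set xs = t ` U" "sorted_wrt (<) xs" "length xs = m"
    using finU inj by (auto simp: xs_def m_def card_image)
  define g where "g i = inv_into U t (xs ! i)" for i
  have gU: "g i \<in> U" and tg: "t (g i) = xs ! i" if "i < m" for i
  proof -
    have "xs ! i \<in> t ` U" using xs that by (metis nth_mem)
    then show "g i \<in> U" "t (g i) = xs ! i" by (auto simp: g_def inv_into_into f_inv_into_f)
  qed
  have g_surj: "\<exists>i<m. x = g i" if "x \<in> U" for x
  proof -
    have "t x \<in> set xs" using that xs by auto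
    then obtain i where "i < m" "t x = xs ! i" using xs by (metis in_set_conv_nth)
    then show ?thesis using inv_into_f_f[OF inj that] by (auto simp: g_def)
  qed
  have g_pos: "cr (g i) (g j) > 0" if "i < j" "j < m" for i j
  proof -
    have U: "g i \<in> U" "g j \<in> U" using gU that by auto
    have lt: "t (g i) < t (g j)" using tg that sorted_wrt_nth_less[OF xs(2)] xs(3) by simp
    have "cr (g i) (g j) = cr (norm (g i) *\<^sub>R udir (t (g i))) (norm (g j) *\<^sub>R udir (t (g j)))"
      using U by (simp only: pf(3))
    also have "\<dots> = norm (g i) * norm (g j) * sin (t (g j) - t (g i))" by (simp add: cr_udir)
    also have "\<dots> > 0"
    proof (intro mult_pos_pos sin_gt_zero)
      show "t (g j) - t (g i) < pi" using pf(1)[OF U(1)] pf(2)[OF U(2)] by linarith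
    qed (use U Unz lt in auto)
    finally show ?thesis .
  qed
  \<comment> \<open>Antiperiodic continuation: each completed block of \<open>m\<close> indices
    changes the sign.\<close>
  define v where "v i = (-1) ^ (i div m) *\<^sub>R g (i mod m)" for i
  have v_lt: "v i = g i" if "i < m" for i using that by (simp add: v_def)
  have anti: "v (i + m) = - v i" for i using m2 by (simp add: v_def)
  have v_shift: "v (i + q * m) = (-1) ^ q *\<^sub>R v i" for i q
    using m2 by (simp add: v_def power_add)
  have pos: "cr (v i) (v j) > 0" if "i < j" "j < i + m" for i j
  proof -
    define q r where "q = i div m" and "r = i mod m"
    have i: "i = r + q * m" "r < m" using m2 by (simp_all add: q_def r_def)
    define k where "k = j - q * m"
    have j: "j = k + q * m" "r < k" "k < r + m" using that i by (auto simp: k_def)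
    have "cr (v i) (v j) = cr (v r) (v k)"
      unfolding i(1) j(1) v_shift by (cases "even q") simp_all
    also have "cr (v r) (v k) > 0"
    proof (cases "k < m")
      case True
      then show ?thesis using g_pos[of r k] i j by (simp add: v_lt)
    next
      case False
      then have "v k = - v (k - m)" using anti[of "k - m"] by simp
      then show ?thesis using g_pos[of "k - m" r] i j False cr_anticomm[of "g r" "g (k - m)"] by (simp add: v_lt)
    qed
    finally show ?thesis .
  qed
  have vV: "v i \<in> V" for i
  proof -
    have "g (i mod m) \<in> V" using gU[of "i mod m"] m2 by (auto simp: U_def)
    then show ?thesis using neg by (cases "even (i div m)") (auto simp: v_def)
  qed
  have convpos: "cr (v i) (v k) + cr (v k) (v j) > cr (v i) (v j)" if "i < k" "k < j" "j \<le> i + m" for i j k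
  proof (cases "j = i + m")
    case True
    then show ?thesis using pos[of i k] pos[of k j] anti[of i] that by simp
  next
    case False
    define b where "b = cr (v i) (v j)"
    have p: "b > 0" "cr (v i) (v k) > 0" "cr (v k) (v j) > 0"
      using pos that False by (auto simp: b_def)
    show ?thesis
    \<comment> \<open>Otherwise Cramer's rule places \<open>v k\<close> in the triangle
      \<open>0\<close>, \<open>v i\<close>, \<open>v j\<close> inside \<open>K\<close>. Being
      extreme, it would be a corner, against the positive determinants.\<close>
    proof (rule ccontr)
      assume "\<not> ?thesis"
      then have le: "cr (v i) (v k) + cr (v k) (v j) \<le> b" by (simp add: b_def)
      define s s' where "s = cr (v k) (v j) / b" and "s' = cr (v i) (v k) / b"
      have ss: "s \<ge> 0" "s' \<ge> 0" "s + s' \<le> 1" using le p by (auto simp: s_def s'_def simp flip: add_divide_distrib)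
      have "v k = (1 / b) *\<^sub>R (b *\<^sub>R v k)" using p by simp
      also have "\<dots> = s *\<^sub>R v i + s' *\<^sub>R v j"
        unfolding b_def cramer[of "v i" "v j" "v k"] by (simp add: s_def s'_def b_def scaleR_add_right)
      finally have "v k \<in> convex hull {0, v i, v j}"
        unfolding convex_hull_3 using ss
        by (intro CollectI exI[of _ "1 - s - s'"] exI[of _ s] exI[of _ s']) auto
      moreover have "convex hull {0, v i, v j} \<subseteq> K"
        using \<open>0 \<in> K\<close> VK vV conv by (intro hull_minimal) auto
      ultimately have "v k extreme_point_of (convex hull {0, v i, v j})"
        using ext[OF vV[of k]] unfolding extreme_point_of_def by blast
      then have "v k \<in> {0, v i, v j}" by (rule extreme_point_of_convex_hull)
      then show False using p by (auto simp: cr_def)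
    qed
  qed
  have poly_v: "symmetric_polygon m v"
    by unfold_locales (use m2 anti pos convpos in auto)
  have vV_eq: "v ` {..<2*m} = V"
  proof (intro equalityI subsetI)
    fix x assume "x \<in> V"
    then consider "x \<in> U" | "- x \<in> U" unfolding V_eq by auto
    then show "x \<in> v ` {..<2*m}"
    proof cases
      case 1
      then obtain i where "i < m" "x = g i" using g_surj by blast
      then show ?thesis by (intro image_eqI[of _ _ i]) (auto simp: v_lt)
    next
      case 2
      then obtain i where "i < m" "- x = g i" using g_surj by blast
      then have "x = v (i + m)" by (metis anti minus_minus v_lt)
      then show ?thesis using \<open>i < m\<close> by auto
    qed
  qed (use vV in auto)
  show ?thesis
  proof (rule that)
    show "K = convex hull (v ` {..<2*m})" unfolding vV_eq by (rule hull)
  qed (use poly_v cardV in \<open>simp_all add: V_def\<close>)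
qed

section \<open>Regular polygons\<close>

lemma linear_udir_rotation:
  obtains R where "linear R" "inj R" "\<And>s. R (udir s) = udir (t + s)"
proof
  let ?R = "\<lambda>x::real^2. vector [cos t * x$1 - sin t * x$2, sin t * x$1 + cos t * x$2] :: real^2"
  show lin: "linear ?R"
    by (rule linearI) (simp_all add: vec2_eq_iff algebra_simps)
  show "inj ?R"
  proof (rule inj_on_inverseI)
    fix x
    have *: "cos t * (cos t * z) + sin t * (sin t * z) = z" for z :: real
      using sin_cos_squared_add3[of t] by (metis distrib_right mult.assoc mult_1)
    show "(\<lambda>y::real^2. vector [cos t * y$1 + sin t * y$2, cos t * y$2 - sin t * y$1]) (?R x) = x"
      by (simp add: vec2_eq_iff algebra_simps) (intro conjI *)
  qed
  show "?R (udir s) = udir (t + s)" for s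
    by (simp add: udir_def cos_add sin_add vec2_eq_iff)
qed

text \<open>The angle step is \<open>pi / m\<close>, since \<open>m\<close> counts the vertices of
  half a turn; the polygon has \<open>2 * m\<close> vertices.\<close>

definition regular_vertex :: "nat \<Rightarrow> nat \<Rightarrow> real^2"
  where "regular_vertex m k = udir (real k * pi / real m)"

lemma cr_regular_vertex:
  "cr (regular_vertex m i) (regular_vertex m j) = sin ((real j - real i) * (pi / real m))"
  by (simp add: regular_vertex_def cr_udir left_diff_distrib diff_divide_distrib)

text \<open>Convex position of three points on the unit circle, in terms of the angles between
  them.\<close>

lemma sin_add_less:
  assumes "0 < x" "0 < y" "x + y \<le> pi"
  shows "sin (x + y) < sin x + sin y"
proof -
  have "cos y < 1" using cos_monotone_0_pi[of 0 y] assms by simp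
  then have "sin x * cos y < sin x" using sin_gt_zero[of x] assms by simp
  moreover have "cos x * sin y \<le> sin y" using sin_gt_zero[of y] assms by simp
  ultimately show ?thesis unfolding sin_add by linarith
qed

lemma symmetric_polygon_regular:
  assumes m: "m \<ge> 2" shows "symmetric_polygon m (regular_vertex m)"
proof
  define h where "h = pi / real m"
  have h: "h > 0" "real m * h = pi" using m by (auto simp: h_def)
  have le: "real d * h \<le> pi" if "d \<le> m" for d
  proof -
    have "real d * h \<le> real m * h" using that h by (intro mult_right_mono) auto
    then show ?thesis using h by simp
  qed
  show "regular_vertex m (i + m) = - regular_vertex m i" for i
  proof -
    have "real (i + m) * pi / real m = real i * pi / real m + pi" using m by (simp add: field_simps)
    then show ?thesis by (simp add: regular_vertex_def udir_def vec2_eq_iff)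
  qed
  show "cr (regular_vertex m i) (regular_vertex m j) > 0" if "i < j" "j < i + m" for i j
    unfolding cr_regular_vertex h_def[symmetric]
  proof (rule sin_gt_zero)
    show "0 < (real j - real i) * h" using that h by simp
    have "(real j - real i) * h < real m * h" using that h by (intro mult_strict_right_mono) auto
    then show "(real j - real i) * h < pi" using h by simp
  qed
  show "cr (regular_vertex m i) (regular_vertex m j)
      < cr (regular_vertex m i) (regular_vertex m k) + cr (regular_vertex m k) (regular_vertex m j)"
    if "i < k" "k < j" "j \<le> i + m" for i k j
  proof -
    have "(real k - real i) * h + (real j - real k) * h \<le> pi"
      using le[of "j - i"] that by (simp add: of_nat_diff flip: distrib_right)
    then show ?thesis
      using sin_add_less[of "(real k - real i) * h" "(real j - real k) * h"] that h
      by (simp add: cr_regular_vertex flip: h_def distrib_right)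
  qed
qed (rule m)

text \<open>The determinants of the dual vertices are a positive multiple of those of the vertices,
  so both areas are exact sums over the fans: \<open>m * sin h\<close> and
  \<open>m * 2 * (1 - cos h) / sin h\<close> with \<open>h = pi / m\<close>.\<close>

lemma regular_area_product:
  fixes m :: nat
  assumes m: "m \<ge> 2"
  defines "P \<equiv> convex hull (regular_vertex m ` {..<2*m})"
  shows "measure lebesgue P * measure lebesgue (polar_body P) = 4 * (m * sin (pi / (2 * m)))\<^sup>2"
proof -
  interpret symmetric_polygon m "regular_vertex m" by (rule symmetric_polygon_regular[OF m])
  define h where "h = pi / real m"
  have h: "0 < h" "h < pi" "real m * h = pi" using m by (auto simp: h_def field_simps)
  have sinh: "sin h > 0" using h by (intro sin_gt_zero)
  have cosh: "cos h < 1" using cos_monotone_0_pi[of 0 h] h by simp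
  have a: "cr (regular_vertex m i) (regular_vertex m (Suc i)) = sin h" for i
    by (simp add: cr_regular_vertex h_def)
  have dual: "cr (dual i) (dual j) = 2 * sin ((real j - real i) * h) * (1 - cos h) / (sin h)\<^sup>2" for i j
  proof -
    define s where "s = (real j - real i) * h"
    have "cr (dual i) (dual j) = (cr (regular_vertex m (Suc i)) (regular_vertex m (Suc j))
      - cr (regular_vertex m (Suc i)) (regular_vertex m j)
      - cr (regular_vertex m i) (regular_vertex m (Suc j))
      + cr (regular_vertex m i) (regular_vertex m j)) / (sin h)\<^sup>2"
      unfolding dual_def a by (simp add: cr_def power2_eq_square algebra_simps add_divide_distrib diff_divide_distrib)
    also have "\<dots> = (2 * sin s - sin (s - h) - sin (s + h)) / (sin h)\<^sup>2"
      unfolding cr_regular_vertex h_def[symmetric] s_def by (simp add: algebra_simps)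
    also have "\<dots> = 2 * sin s * (1 - cos h) / (sin h)\<^sup>2"
      by (simp add: sin_add sin_diff algebra_simps)
    finally show ?thesis by (simp add: s_def)
  qed
  have "cr (dual i) (dual j) > 0" if "i < j" "j < i + m" for i j
  proof -
    have "(real j - real i) * h < real m * h" using that h by (intro mult_strict_right_mono) auto
    then have "sin ((real j - real i) * h) > 0" using that h by (intro sin_gt_zero) auto
    then show ?thesis unfolding dual using sinh cosh by simp
  qed
  then have "measure lebesgue (polar_body P) = real m * (2 * (1 - cos h) / sin h)"
    unfolding P_def using sinh by (subst polar_area_eq) (auto simp: dual power2_eq_square)
  moreover have "measure lebesgue P = real m * sin h"
    unfolding P_def area_eq by (simp add: a)
  moreover have "1 - cos h = 2 * (sin (h / 2))\<^sup>2"
    using cos_double_sin[of "h / 2"] by simp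
  ultimately show ?thesis
    using sinh by (simp add: h_def power2_eq_square mult.commute)
qed

lemma polar_lmeasurable_regular:
  assumes "m \<ge> 2"
  shows "polar_body (convex hull (regular_vertex m ` {..<2*m})) \<in> lmeasurable"
proof -
  interpret symmetric_polygon m "regular_vertex m" by (rule symmetric_polygon_regular[OF assms])
  show ?thesis by (rule polar_lmeasurable)
qed

section \<open>Linear images and affine regularity\<close>

text \<open>The adjoint maps the polar body of the image onto the polar body of \<open>S\<close> and
  has the same determinant as \<open>A\<close>, so the two factors cancel.\<close>

lemma area_product_linear_image:
  fixes A :: "real^('n::{finite,wellorder}) \<Rightarrow> real^('n::{finite,wellorder})"
  assumes A: "linear A" "inj A" and S: "S \<in> lmeasurable" "polar_body S \<in> lmeasurable"
  shows "measure lebesgue (A ` S) * measure lebesgue (polar_body (A ` S)) =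
    measure lebesgue S * measure lebesgue (polar_body S)"
proof -
  define B where "B = adjoint A"
  have B: "linear B" unfolding B_def by (rule adjoint_linear[OF A(1)])
  have adj: "B x \<bullet> y = x \<bullet> A y" for x y
    using adjoint_works[OF A(1), of y x] by (simp add: B_def inner_commute)
  have surjA: "surj A" using A by (simp add: linear_injective_imp_surjective)
  have injB: "inj B"
    unfolding linear_injective_0[OF B]
  proof (intro allI impI)
    fix x assume "B x = 0"
    obtain y where "x = A y" using surjA by (metis surjD)
    then show "x = 0" using adj[of x y] \<open>B x = 0\<close> by simp
  qed
  obtain C where C: "linear C" "\<And>x. C (B x) = x" "\<And>x. B (C x) = x"
    using linear_injective_isomorphism[OF B injB] by blast
  have image: "B ` polar_body (A ` S) = polar_body S"
  proof (intro equalityI subsetI)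
    fix z assume "z \<in> polar_body S"
    then have "C z \<in> polar_body (A ` S)"
      using adj[of "C z"] by (auto simp: polar_body_def C)
    then show "z \<in> B ` polar_body (A ` S)" using C(3)[of z] by (metis image_eqI)
  qed (auto simp: polar_body_def adj)
  have "C ` polar_body S = polar_body (A ` S)"
    unfolding image[symmetric] image_image by (simp add: C)
  then have "polar_body (A ` S) \<in> lmeasurable"
    using measurable_linear_image[OF C(1) S(2)] by simp
  then have "measure lebesgue (polar_body S) = \<bar>det (matrix B)\<bar> * measure lebesgue (polar_body (A ` S))"
    using measure_linear_image[OF B] image by metis
  moreover have "det (matrix B) = det (matrix A)"
    unfolding B_def by (simp add: matrix_adjoint[OF A(1)] det_transpose)
  ultimately show ?thesis using measure_linear_image[OF A(1) S(1)] by simp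
qed

text \<open>A translation by \<open>d\<close> raises the maximum of \<open>d \<bullet> x\<close>
  over \<open>S\<close> by \<open>d \<bullet> d\<close>.\<close>

lemma no_translation_invariance:
  fixes S :: "'a::euclidean_space set"
  assumes "compact S" "S \<noteq> {}" "(+) d ` S \<subseteq> S"
  shows "d = 0"
proof -
  obtain x where x: "x \<in> S" "\<And>y. y \<in> S \<Longrightarrow> d \<bullet> y \<le> d \<bullet> x"
    using continuous_attains_sup[OF assms(1,2), of "\<lambda>x. d \<bullet> x"] continuous_on_inner[OF continuous_on_const continuous_on_id]
    by blast
  then have "d \<bullet> (d + x) \<le> d \<bullet> x" using assms(3) by blast
  then show ?thesis by (simp add: inner_add_right) (metis inner_eq_zero_iff inner_ge_zero order_antisym)
qed

text \<open>Radius, rotation and linear part combine to \<open>M\<close>, so \<open>K\<close> is the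
  translate by \<open>d\<close> of the image under \<open>M\<close> of the standard polygon. Both
  sets being symmetric, translation by \<open>d + d\<close> maps that compact image into itself,
  whence \<open>d = 0\<close>.\<close>

lemma affinely_regular_imp_linear_image:
  assumes m: "m \<ge> 2" and K: "o_symmetric K" "affinely_regular_polygon (2 * m) K"
  obtains M where "linear M" "inj M" "K = M ` (convex hull (regular_vertex m ` {..<2*m}))"
proof -
  obtain P A b where reg: "regular_polygon (2 * m) P" and A: "linear A" "inj A"
    and KP: "K = (\<lambda>x. A x + b) ` P"
    using K(2) unfolding affinely_regular_polygon_def by blast
  obtain c r \<theta> where r: "r > 0"
    and P: "P = convex hull ((\<lambda>k. c + r *\<^sub>R vector [cos (\<theta> + 2 * pi * real k / real (2 * m)),
                               sin (\<theta> + 2 * pi * real k / real (2 * m))]) ` {..<2*m})"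
    using reg unfolding regular_polygon_def by blast
  obtain R where R: "linear R" "inj R" "\<And>s. R (udir s) = udir (\<theta> + s)"
    using linear_udir_rotation by blast
  define P0 where "P0 = convex hull (regular_vertex m ` {..<2*m})"
  define M where "M x = r *\<^sub>R A (R x)" for x
  define d where "d = A c + b"
  have linM: "linear M"
    unfolding M_def using linear_compose[OF R(1) A(1)]
    by (auto simp: linear_iff scaleR_add_right)
  have injM: "inj M"
  proof (rule injI)
    fix x y assume "M x = M y"
    then have "A (R x) = A (R y)" using r by (simp add: M_def)
    then show "x = y" using A(2) R(2) by (simp add: inj_eq)
  qed
  have "(\<lambda>k. c + r *\<^sub>R vector [cos (\<theta> + 2 * pi * real k / real (2 * m)),
                               sin (\<theta> + 2 * pi * real k / real (2 * m))]) ` {..<2*m}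
      = (+) c ` (\<lambda>x. r *\<^sub>R R x) ` regular_vertex m ` {..<2*m}"
    unfolding image_image
    by (intro image_cong refl) (simp add: R(3) regular_vertex_def, simp add: udir_def mult.commute)
  then have "P = convex hull ((+) c ` (\<lambda>x. r *\<^sub>R R x) ` regular_vertex m ` {..<2*m})"
    unfolding P by (rule arg_cong)
  also have "\<dots> = (+) c ` (\<lambda>x. r *\<^sub>R R x) ` P0"
    unfolding P0_def convex_hull_translation
      convex_hull_linear_image[OF linear_compose_scale_right[OF R(1)]] ..
  finally have P': "P = (+) c ` (\<lambda>x. r *\<^sub>R R x) ` P0" .
  have KM: "K = (+) d ` M ` P0"
    unfolding KP P' image_image M_def d_def
    by (intro image_cong refl) (simp add: linear_add[OF A(1)] linear_scale[OF A(1)])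
  have compact: "compact (M ` P0)"
    unfolding P0_def
    by (intro compact_continuous_image linear_continuous_on linM finite_imp_compact_convex_hull)
      (auto simp: linM linear_linear)
  interpret symmetric_polygon m "regular_vertex m" by (rule symmetric_polygon_regular[OF m])
  have "- x \<in> P0" if "x \<in> P0" for x
  proof -
    have "uminus ` P0 = convex hull (uminus ` regular_vertex m ` {..<2*m})"
      unfolding P0_def by (rule convex_hull_linear_image) (simp add: linear_iff)
    also have "\<dots> \<subseteq> P0"
    proof (rule hull_minimal)
      show "uminus ` regular_vertex m ` {..<2*m} \<subseteq> P0"
        using v_in_hull by (auto simp: P0_def simp flip: anti)
    qed (simp add: P0_def)
    finally show ?thesis using that by auto
  qed
  then have negM: "- y \<in> M ` P0" if "y \<in> M ` P0" for y
    using that linear_neg[OF linM] by (auto simp flip: linear_neg[OF linM])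
  have "(+) (d + d) ` M ` P0 \<subseteq> M ` P0"
  proof safe
    fix x assume "x \<in> P0"
    then have "d + M x \<in> K" by (auto simp: KM)
    then have "- (d + M x) \<in> K" by (rule uminus_mem_o_symmetric[OF K(1)])
    then obtain y where y: "y \<in> P0" "- (d + M x) = d + M y" unfolding KM by blast
    have "d + M x = - (d + M y)" by (simp only: y(2)[symmetric] minus_minus)
    then have "d + d + M x = d + - (d + M y)" by (simp only: add.assoc)
    also have "\<dots> = - M y" by simp
    finally have "d + d + M x = - M y" .
    then show "d + d + M x \<in> M ` P0" using negM y(1) by simp
  qed
  then have "d + d = 0"
    using compact zero_in_hull by (intro no_translation_invariance[of "M ` P0"]) (auto simp: P0_def)
  then have "d = 0" by (simp flip: scaleR_2)
  then show ?thesis using that[OF linM injM] KM by (simp add: P0_def)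
qed

text \<open>The functionals \<open>d\<close> and \<open>e\<close> are the rows of a linear map
  sending each \<open>v i\<close> to \<open>regular_vertex m i\<close>; its inverse exhibits the
  polygon as a linear image of the regular one.\<close>

lemma (in symmetric_polygon) affinely_regularI:
  assumes de: "\<And>i. cos (i * pi / m) = d \<bullet> v i \<and> sin (i * pi / m) = e \<bullet> v i"
  shows "affinely_regular_polygon (2 * m) (convex hull (v ` {..<2*m}))"
proof -
  define B where "B x = (vector [d \<bullet> x, e \<bullet> x] :: real^2)" for x
  have B: "linear B"
    by (rule linearI) (simp_all add: B_def vec2_eq_iff inner_add_right)
  have Bv: "B (v i) = regular_vertex m i" for i
    using de[of i] by (simp add: B_def regular_vertex_def udir_def)
  interpret reg: symmetric_polygon m "regular_vertex m" by (rule symmetric_polygon_regular[OF m_ge_2])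
  have "inj B"
    unfolding linear_injective_0[OF B]
  proof (intro allI impI)
    fix x assume "B x = 0"
    define s t where "s = cr x (v 1)" and "t = cr (v 0) x"
    have x: "cr (v 0) (v 1) *\<^sub>R x = s *\<^sub>R v 0 + t *\<^sub>R v 1"
      unfolding s_def t_def by (rule cramer)
    from arg_cong[OF this, of B] have "s *\<^sub>R regular_vertex m 0 + t *\<^sub>R regular_vertex m 1 = 0"
      using \<open>B x = 0\<close> by (simp add: linear_add[OF B] linear_scale[OF B] Bv)
    then have "cr (s *\<^sub>R regular_vertex m 0 + t *\<^sub>R regular_vertex m 1) (regular_vertex m 1) = 0"
      "cr (regular_vertex m 0) (s *\<^sub>R regular_vertex m 0 + t *\<^sub>R regular_vertex m 1) = 0"
      by (simp_all add: cr_def)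
    then have "s = 0" "t = 0" using reg.consecutive_pos[of 0] by (simp_all add: cr_add)
    then show "x = 0" using x consecutive_pos[of 0] by simp
  qed
  obtain A where A: "linear A" "\<And>x. A (B x) = x" "\<And>x. B (A x) = x"
    using linear_injective_isomorphism[OF B \<open>inj B\<close>] by blast
  have "inj A" using A by (metis injI)
  have Av: "A (regular_vertex m i) = v i" for i using A(2) Bv by metis
  have "convex hull (v ` {..<2*m}) = A ` (convex hull (regular_vertex m ` {..<2*m}))"
    unfolding convex_hull_linear_image[OF A(1)] image_image Av ..
  moreover have "regular_vertex m ` {..<2*m} = (\<lambda>k. 0 + 1 *\<^sub>R vector
      [cos (0 + 2 * pi * real k / real (2 * m)), sin (0 + 2 * pi * real k / real (2 * m))]) ` {..<2*m}"
    by (intro image_cong refl) (simp add: regular_vertex_def udir_def mult.commute)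
  then have "regular_polygon (2 * m) (convex hull (regular_vertex m ` {..<2*m}))"
    unfolding regular_polygon_def using m_ge_2
    by (intro conjI exI[of _ 0] exI[of _ 1] arg_cong[of _ _ "\<lambda>S. convex hull S"]) auto
  ultimately show ?thesis
    unfolding affinely_regular_polygon_def using A(1) \<open>inj A\<close>
    by (intro exI[of _ "convex hull (regular_vertex m ` {..<2*m})"] exI[of _ A] exI[of _ 0]) auto
qed

theorem theoremA:
  fixes n :: nat and K :: "(real^2) set"
  assumes "even n" and "n \<ge> 6"
    and "convex_polygon K" and "o_symmetric K" and "card (vertices K) \<le> n"
  shows "measure lebesgue K * measure lebesgue (polar_body K) \<le> (real n)\<^sup>2 * (sin (pi / real n))\<^sup>2
    \<and> (measure lebesgue K * measure lebesgue (polar_body K) = (real n)\<^sup>2 * (sin (pi / real n))\<^sup>2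
         \<longleftrightarrow> affinely_regular_polygon n K)"
proof -
  obtain N where N: "n = 2 * N" "N \<ge> 2" using assms(1,2) by (elim evenE) auto
  have bound: "(real n)\<^sup>2 * (sin (pi / real n))\<^sup>2 = 4 * (N * sin (pi / (2 * N)))\<^sup>2"
    by (simp add: N power_mult_distrib)
  obtain m v where mv: "symmetric_polygon m v" "2 * m = card (vertices K)"
    and K: "K = convex hull (v ` {..<2*m})"
    using ex_symmetric_polygon[OF assms(3,4)] by blast
  interpret symmetric_polygon m v by (rule mv(1))
  have "m \<le> N" using mv(2) assms(5) N by simp
  note area_product = area_product[OF this]
  \<comment> \<open>The upper bounds by the fans suffice here, also for equality, which squeezes the
    product of the two sums between equal values.\<close>
  have le: "measure lebesgue K * measure lebesgue (polar_body K)
      \<le> (\<Sum>i<m. a i) * (\<Sum>i<m. cr (dual i) (dual (Suc i)))"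
    unfolding K using consecutive_pos
    by (intro mult_mono area_le polar_area_le sum_nonneg) (auto intro: less_imp_le)
  show ?thesis
    unfolding bound
  proof (intro conjI iffI)
    show "measure lebesgue K * measure lebesgue (polar_body K) \<le> 4 * (N * sin (pi / (2 * N)))\<^sup>2"
      using le area_product(1) by simp
  next
    assume "measure lebesgue K * measure lebesgue (polar_body K) = 4 * (N * sin (pi / (2 * N)))\<^sup>2"
    then have "(\<Sum>i<m. a i) * (\<Sum>i<m. cr (dual i) (dual (Suc i))) = 4 * (N * sin (pi / (2 * N)))\<^sup>2"
      using le area_product(1) by simp
    then obtain d e where "m = N" "\<And>i. cos (i * pi / m) = d \<bullet> v i \<and> sin (i * pi / m) = e \<bullet> v i"
      using area_product(2) by blast
    then show "affinely_regular_polygon n K"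
      using affinely_regularI[of d e] by (simp add: K N)
  next
    \<comment> \<open>Linear invariance of the area product reduces this direction to the explicit
      value for the regular polygon.\<close>
    assume "affinely_regular_polygon n K"
    then obtain M where M: "linear M" "inj M" "K = M ` (convex hull (regular_vertex N ` {..<2*N}))"
      using affinely_regular_imp_linear_image[OF N(2) assms(4)] N(1) by blast
    show "measure lebesgue K * measure lebesgue (polar_body K) = 4 * (N * sin (pi / (2 * N)))\<^sup>2"
      unfolding M(3)
      by (subst area_product_linear_image[OF M(1,2)])
        (auto simp: regular_area_product N polar_lmeasurable_regular lmeasurable_compact
          finite_imp_compact_convex_hull)
  qed
qed

end
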